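(* Let $E$ be a Polish space, $\Theta$ an open convex subset of $\mathbb{R}^d$, and $(\mu_\theta)_{\theta\in\Theta}$ a family of Borel probability measures on $E$ that are all absolutely continuous with respect to a $\sigma$-finite measure $\lambda$ on $(E,\mathcal{B}(E))$, with densities $f_\theta=d\mu_\theta/d\lambda$. Assume that - $f_\theta(x)>0$ for every $\theta\in\Theta$ and $x\in E$; - $x\mapsto\log f_\theta(x)$ is continuous for every $\theta\in\Theta$; - $\theta\mapsto\log f_\theta(x)$ is concave for every $x\in E$. Let $(\theta_k)_{k\in\mathbb{N}}$ be a sequence enumerating $\Theta\cap\mathbb{Q}^d$ and let $\psi_k(x):=|\log f_{\theta_k}(x)|$ for $x\in E$, $k\in\mathbb{N}$. Let $\mathcal{M}\subseteq\mathcal{M}_1$ and let $T:\mathcal{M}\to\Theta$ be a maximum likelihood functional. Let $\mu\in\mathcal{M}$ be such that the map $\mathcal{L}_\mu:\Theta\to\mathbb{R}$, $\mathcal{L}_\mu(\theta):=\int\log f_\theta\,d\mu$, has a unique maximum point. Then $T(\mu_n)\to T(\mu)$ for any sequence $(\mu_n)\subset\mathcal{M}$ which satisfies $\mathcal{L}_{\mu_n}(\theta_k)\to\mathcal{L}_\mu(\theta_k)$ for every $k\in\mathbb{N}$. In particular, $T$ is continuous at $\mu$ with respect to the (relative) $(\psi_k)$-weak topology.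
   Context: $\mathcal{M}_1$ is the set of all Borel probability measures on $E$. A map $T:\mathcal{M}\to\Theta$, where $\mathcal{M}\subseteq\mathcal{M}_1$ contains all empirical probability measures $\frac1n\sum_{i=1}^n\delta_{x_i}$ ($x_1,\dots,x_n\in E$, $n\in\mathbb{N}$), is called a maximum likelihood functional (associated with the model $(\mu_\theta)_{\theta\in\Theta}$ with densities $f_\theta$) if for every $\mu\in\mathcal{M}$ the integrals $\int|\log f_\theta|\,d\mu$, $\theta\in\Theta$, are finite and $T(\mu)\in\arg\max_{\theta\in\Theta}\int\log f_\theta\,d\mu$. For a sequence of continuous functions $\psi_k:E\to[0,\infty)$, $\mathcal{M}_1^{(\psi_k)}$ is the set of all $\mu\in\mathcal{M}_1$ with $\int\psi_k\,d\mu<\infty$ for every $k$, and the $(\psi_k)$-weak topology on it is the coarsest topology making all mappings $\mu\mapsto\int f\,d\mu$ continuous, where $f$ ranges over all continuous $f:E\to\mathbb{R}$ such that $\sup_{x\in E}|f(x)/(1+\psi_k(x))|<\infty$ for some $k\in\mathbb{N}$. The set $\mathcal{M}$ is contained in $\mathcal{M}_1^{(\psi_k)}$ by the definition of maximum likelihood functional, and carries the relative topology. $\mathbb{R}^d$ carries the Euclidean norm. *)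

theory Defs
  imports "HOL-Probability.Probability"
begin

definition borel_prob_measures :: "'a::topological_space measure set"  (\<open>\<M>\<^sub>1\<close>)
  where "\<M>\<^sub>1 = {\<mu>. sets \<mu> = sets borel \<and> prob_space \<mu>}"

definition empirical_measure :: "nat \<Rightarrow> (nat \<Rightarrow> 'a::topological_space) \<Rightarrow> 'a measure"
  where "empirical_measure n x =
    measure_of UNIV (sets borel)
      (\<lambda>A. ennreal (1 / real n) * (\<Sum>i<n. emeasure (return borel (x i)) A))"

definition log_likelihood :: "('p \<Rightarrow> 'a \<Rightarrow> real) \<Rightarrow> 'a measure \<Rightarrow> 'p \<Rightarrow> real"  (\<open>\<L>\<close>)
  where "\<L> f \<mu> \<theta> = (\<integral>x. ln (f \<theta> x) \<partial>\<mu>)"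

text \<open>
  For measurable \<open>f \<theta>\<close>, integrability of \<open>\<bar>ln (f \<theta> x)\<bar>\<close> is finiteness of its integral.
  Mathematically, \<open>T\<close> is undefined outside \<open>\<M>\<close>; its values there are irrelevant.
\<close>

definition ml_functional ::
  "'p set \<Rightarrow> ('p \<Rightarrow> 'a::topological_space \<Rightarrow> real) \<Rightarrow> 'a measure set \<Rightarrow> ('a measure \<Rightarrow> 'p) \<Rightarrow> bool"
  where "ml_functional \<Theta> f \<M> T \<longleftrightarrow>
    \<M> \<subseteq> \<M>\<^sub>1 \<and>
    (\<forall>n>0. \<forall>x. empirical_measure n x \<in> \<M>) \<and>
    T \<in> \<M> \<rightarrow> \<Theta> \<and>
    (\<forall>\<mu>\<in>\<M>. (\<forall>\<theta>\<in>\<Theta>. integrable \<mu> (\<lambda>x. \<bar>ln (f \<theta> x)\<bar>)) \<and>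
             is_arg_max (\<L> f \<mu>) (\<lambda>\<theta>. \<theta> \<in> \<Theta>) (T \<mu>))"

text \<open>
  A gauge \<open>\<psi>\<close> is meant to consist of continuous functions into \<open>[0, \<infinity>)\<close>. The
  coarsest topology making all \<open>\<mu> \<mapsto> \<integral>g d\<mu>\<close> continuous has the preimages of the open sets
  of reals under these maps as a subbase.
\<close>

definition gauge_measures :: "(nat \<Rightarrow> 'a::topological_space \<Rightarrow> real) \<Rightarrow> 'a measure set"
  where "gauge_measures \<psi> = {\<mu> \<in> \<M>\<^sub>1. \<forall>k. integrable \<mu> (\<psi> k)}"

definition gauge_test_functions ::
  "(nat \<Rightarrow> 'a::topological_space \<Rightarrow> real) \<Rightarrow> ('a \<Rightarrow> real) set"
  where "gauge_test_functions \<psi> =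
    {g. continuous_on UNIV g \<and> (\<exists>k. bdd_above (range (\<lambda>x. \<bar>g x / (1 + \<psi> k x)\<bar>)))}"

definition gauge_weak_topology ::
  "(nat \<Rightarrow> 'a::topological_space \<Rightarrow> real) \<Rightarrow> 'a measure topology"
  where "gauge_weak_topology \<psi> = topology_generated_by
    {{\<mu> \<in> gauge_measures \<psi>. (\<integral>x. g x \<partial>\<mu>) \<in> U} | g U.
       g \<in> gauge_test_functions \<psi> \<and> open U}"

definition rational_points :: "(real ^ 'n) set"
  where "rational_points = {\<theta>. \<forall>i. \<theta> $ i \<in> \<rat>}"

lemma space_empirical_measure [simp]: "space (empirical_measure n x) = UNIV"
  and sets_empirical_measure [simp]: "sets (empirical_measure n x) = sets borel"
  using sets.sigma_sets_eq[of "borel :: 'a::topological_space measure"]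
  by (simp_all add: empirical_measure_def space_measure_of_conv sets_measure_of_conv)

lemma emeasure_empirical_measure:
  assumes "A \<in> sets borel"
  shows "emeasure (empirical_measure n x) A = ennreal (1 / real n) * (\<Sum>i<n. indicator A (x i))"
proof -
  let ?m = "\<lambda>A. ennreal (1 / real n) * (\<Sum>i<n. emeasure (return borel (x i)) A)"
  have "countably_additive (sets borel) ?m"
  proof (rule countably_additiveI)
    fix F :: "nat \<Rightarrow> 'a set"
    assume F: "range F \<subseteq> sets borel" "disjoint_family F"
    have "(\<Sum>j. ?m (F j)) = ennreal (1 / real n) * (\<Sum>i<n. \<Sum>j. emeasure (return borel (x i)) (F j))"
      by (simp add: suminf_sum)
    also have "\<dots> = ?m (\<Union>j. F j)"
      using F by (simp add: suminf_emeasure del: emeasure_return)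
    finally show "(\<Sum>j. ?m (F j)) = ?m (\<Union>j. F j)" .
  qed
  moreover have "positive (sets borel) ?m"
    by (simp add: positive_def)
  ultimately have "emeasure (empirical_measure n x) A = ?m A"
    using assms by (intro emeasure_measure_of[OF empirical_measure_def]) auto
  with assms show ?thesis by simp
qed

lemma empirical_measure_in_borel_prob_measures:
  assumes "n > 0"
  shows "empirical_measure n x \<in> \<M>\<^sub>1"
proof -
  have "emeasure (empirical_measure n x) (space (empirical_measure n x)) = 1"
    using assms by (simp add: emeasure_empirical_measure ennreal_of_nat_eq_real_of_nat
        flip: ennreal_mult)
  then show ?thesis
    by (simp add: borel_prob_measures_def prob_spaceI)
qed

lemma topspace_gauge_weak_topology: "topspace (gauge_weak_topology \<psi>) = gauge_measures \<psi>"
proof -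
  have "(\<lambda>_. 0) \<in> gauge_test_functions \<psi>"
    by (auto simp: gauge_test_functions_def)
  then show ?thesis
    unfolding gauge_weak_topology_def topology_generated_by_topspace
    by (auto intro!: exI[of _ "gauge_measures \<psi>"] exI[of _ "\<lambda>_. 0"] exI[of _ UNIV])
qed

end

theory Submission imports Defs begin

text \<open>
  Each \<open>\<L> f \<nu>\<close> is concave on \<open>\<Theta>\<close>. If a concave \<open>h\<close> is close to the concave \<open>g = \<L> f \<mu>\<close>
  at the vertices and at the centre \<open>p\<close> of a small cube with rational vertices, then on this cube
  it is bounded below by its values at the vertices, and hence bounded above through
  \<open>h x \<le> 2 h p - h (2 p - x)\<close>. A small sphere around the maximum point of \<open>g\<close> is covered by finitely
  many such cubes, so closeness of \<open>h\<close> to \<open>g\<close> at finitely many rational points makes \<open>h\<close> smaller on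
  the whole sphere than at some point inside, and by concavity every maximum point of \<open>h\<close> lies inside.
  Since only finitely many points are involved, this gives a neighbourhood in the gauge weak
  topology as well as the statement about sequences.
\<close>

section \<open>Cubes with rational vertices\<close>

lemma cube_eq_convex_hull:
  fixes p :: "real ^ 'n"
  assumes "r > 0"
  shows "{x. \<forall>i. \<bar>x $ i - p $ i\<bar> \<le> r} = convex hull {v. \<forall>i. v $ i = p $ i - r \<or> v $ i = p $ i + r}"
    (is "?C = convex hull ?W")
proof -
  \<comment> \<open>The affine map \<open>?A\<close> carries the unit cube, which is the hull of its
    0-1 vertices, onto the cube of half-side \<open>r\<close> about \<open>p\<close>. Taking convex
    hulls commutes with affine maps.\<close>
  let ?A = "\<lambda>x. (\<chi> i. p $ i - r) + (2 * r) *\<^sub>R (x :: real ^ 'n)"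
  let ?V = "{v :: real ^ 'n. \<forall>i. v $ i = 0 \<or> v $ i = 1}"
  have "?V = {v. \<forall>i\<in>Basis. v \<bullet> i = 0 \<or> v \<bullet> i = 1}"
    by (auto simp: Basis_vec_def inner_axis)
  moreover have "{x :: real ^ 'n. \<forall>i. 0 \<le> x $ i \<and> x $ i \<le> 1} = cbox 0 One"
    by (simp add: set_eq_iff mem_box_cart flip: Cart_1)
  ultimately have unit: "{x :: real ^ 'n. \<forall>i. 0 \<le> x $ i \<and> x $ i \<le> 1} = convex hull ?V"
    by (simp only: unit_interval_convex_hull)
  have inv: "y = ?A ((1 / (2 * r)) *\<^sub>R (y - (\<chi> i. p $ i - r)))" for y
    using assms by simp
  have W: "?W = ?A ` ?V"
  proof (intro equalityI subsetI)
    fix y assume "y \<in> ?W"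
    then have "(1 / (2 * r)) *\<^sub>R (y - (\<chi> i. p $ i - r)) \<in> ?V"
      using assms by (auto simp: field_simps)
    with inv[of y] show "y \<in> ?A ` ?V" by (rule image_eqI)
  next
    fix y assume "y \<in> ?A ` ?V"
    then show "y \<in> ?W" by auto
  qed
  have C: "?C = ?A ` {x. \<forall>i. 0 \<le> x $ i \<and> x $ i \<le> 1}"
  proof (intro equalityI subsetI)
    fix y assume y: "y \<in> ?C"
    have "0 \<le> (y $ i - (p $ i - r)) / (2 * r) \<and> (y $ i - (p $ i - r)) / (2 * r) \<le> 1" for i
    proof -
      have "\<bar>y $ i - p $ i\<bar> \<le> r" using y by simp
      then show ?thesis using assms by (simp add: field_simps abs_le_iff)
    qed
    then have "(1 / (2 * r)) *\<^sub>R (y - (\<chi> i. p $ i - r)) \<in> {x. \<forall>i. 0 \<le> x $ i \<and> x $ i \<le> 1}"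
      by simp
    with inv[of y] show "y \<in> ?A ` {x. \<forall>i. 0 \<le> x $ i \<and> x $ i \<le> 1}" by (rule image_eqI)
  next
    fix y assume "y \<in> ?A ` {x. \<forall>i. 0 \<le> x $ i \<and> x $ i \<le> 1}"
    then obtain x where x: "y = ?A x" "\<And>i. 0 \<le> x $ i \<and> x $ i \<le> 1" by auto
    have "\<bar>2 * r * x $ i - r\<bar> \<le> r" for i
      using mult_left_mono[of "x $ i" 1 "2 * r"] mult_nonneg_nonneg[of "2 * r" "x $ i"] x(2)[of i] assms
      by (simp add: abs_le_iff)
    with x(1) show "y \<in> ?C" by (simp add: algebra_simps)
  qed
  show ?thesis
    unfolding C W unit by (rule convex_hull_affinity[symmetric])
qed

text \<open>The point \<open>s\<close> may be irrational, so the cube is centred at a nearby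
  rational point \<open>p\<close> instead, with rational half-side. It still contains
  \<open>s\<close> in its interior, and reflection in \<open>p\<close> maps it to itself.\<close>

lemma rational_cube_in_open:
  fixes s :: "real ^ 'n"
  assumes "open U" "s \<in> U"
  obtains p W where "p \<in> rational_points" "p \<in> U" "finite W" "W \<subseteq> rational_points"
    "convex hull W \<subseteq> U" "s \<in> interior (convex hull W)"
    "\<And>x. x \<in> convex hull W \<Longrightarrow> 2 *\<^sub>R p - x \<in> convex hull W"
proof -
  obtain e where e: "e > 0" "ball s e \<subseteq> U"
    using assms open_contains_ball by blast
  \<comment> \<open>A point of the cube differs from \<open>s\<close> by at most
    \<open>2 * r\<close> in each coordinate, \<open>r\<close> for its distance to \<open>p\<close>
    and \<open>r\<close> for that from \<open>p\<close> to \<open>s\<close>. Summing over all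
    coordinates bounds the norm and dictates the factor \<open>2 * real CARD('n)\<close>.\<close>
  obtain r where r: "r \<in> \<rat>" "0 < r" "r < e / (2 * real CARD('n))"
    using Rats_dense_in_real[of 0 "e / (2 * real CARD('n))"] e by auto
  have "\<exists>q\<in>\<rat>. s $ i < q \<and> q < s $ i + r" for i
    using Rats_dense_in_real[of "s $ i" "s $ i + r"] r by auto
  then obtain q where q: "\<And>i. q i \<in> \<rat> \<and> s $ i < q i \<and> q i < s $ i + r"
    by metis
  define p where "p = (\<chi> i. q i)"
  define W where "W = {v. \<forall>i. v $ i = p $ i - r \<or> v $ i = p $ i + r}"
  have hull: "convex hull W = {x. \<forall>i. \<bar>x $ i - p $ i\<bar> \<le> r}"
    unfolding W_def using cube_eq_convex_hull[OF r(2), of p] by simp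
  have sub: "convex hull W \<subseteq> U"
  proof
    fix x assume "x \<in> convex hull W"
    then have "\<bar>x $ i - p $ i\<bar> \<le> r" for i by (simp add: hull)
    then have "\<bar>(x - s) $ i\<bar> \<le> 2 * r" for i
      using q[of i] by (simp add: p_def abs_le_iff) (smt (verit))
    then have "norm (x - s) \<le> (\<Sum>i::'n\<in>UNIV. 2 * r)"
      by (intro order_trans[OF norm_le_l1_cart] sum_mono)
    also have "\<dots> < e" using r(3) by (simp add: field_simps)
    finally show "x \<in> U" using e(2) by (auto simp: dist_norm norm_minus_commute)
  qed
  show ?thesis
  proof
    show "p \<in> rational_points" using q by (simp add: rational_points_def p_def)
    have "p \<in> convex hull W" using r by (simp add: hull)
    with sub show "p \<in> U" by blast
    \<comment> \<open>A vertex is determined by the set of coordinates in which it takes the larger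
      value, and there are finitely many such sets.\<close>
    have "W \<subseteq> range (\<lambda>S. \<chi> i. if i \<in> S then p $ i + r else p $ i - r)"
    proof
      fix v assume "v \<in> W"
      then have "v = (\<chi> i. if i \<in> {i. v $ i = p $ i + r} then p $ i + r else p $ i - r)"
        by (auto simp: W_def vec_eq_iff)
      then show "v \<in> range (\<lambda>S. \<chi> i. if i \<in> S then p $ i + r else p $ i - r)" by blast
    qed
    then show "finite W" by (rule finite_subset) simp
    show "W \<subseteq> rational_points"
    proof
      fix v assume v: "v \<in> W"
      have "v $ i \<in> \<rat>" for i
      proof -
        have "v $ i = q i - r \<or> v $ i = q i + r" using v by (simp add: W_def p_def)
        then show ?thesis using q[of i] r(1) by auto
      qed
      then show "v \<in> rational_points" by (simp add: rational_points_def)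
    qed
    show "convex hull W \<subseteq> U" by (fact sub)
    have "box (p - (\<chi> i. r)) (p + (\<chi> i. r)) \<subseteq> convex hull W"
      by (auto simp: hull mem_box_cart abs_le_iff algebra_simps) (smt (verit))+
    moreover have "s \<in> box (p - (\<chi> i. r)) (p + (\<chi> i. r))"
      unfolding mem_box_cart
    proof
      fix i
      show "(p - (\<chi> i. r)) $ i < s $ i \<and> s $ i < (p + (\<chi> i. r)) $ i"
        using q[of i] r(2) by (simp add: p_def)
    qed
    ultimately show "s \<in> interior (convex hull W)"
      using interior_maximal open_box by blast
    show "2 *\<^sub>R p - x \<in> convex hull W" if x: "x \<in> convex hull W" for x
    proof -
      have "\<bar>2 * p $ i - x $ i - p $ i\<bar> \<le> r" for i
      proof -
        have "\<bar>x $ i - p $ i\<bar> \<le> r" using x by (simp add: hull)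
        then show ?thesis by linarith
      qed
      then show ?thesis by (simp add: hull)
    qed
  qed
qed

section \<open>Stability of maximum points of concave functions\<close>

text \<open>The point is uniformity: \<open>V\<close> and \<open>K\<close> are chosen before
  \<open>h\<close>, so a compactness argument can later combine finitely many of these bounds for
  all \<open>h\<close> at once.\<close>

lemma concave_on_local_upper_bound:
  fixes g :: "real ^ 'n \<Rightarrow> real"
  assumes "open \<Theta>" "continuous_on \<Theta> g" "s \<in> \<Theta>" "d > 0"
  shows "\<exists>V K. open V \<and> s \<in> V \<and> finite K \<and> K \<subseteq> \<Theta> \<inter> rational_points \<and>
     (\<forall>h x. concave_on \<Theta> h \<longrightarrow> (\<forall>q\<in>K. \<bar>h q - g q\<bar> < d) \<longrightarrow> x \<in> V \<longrightarrow> h x \<le> g s + 6 * d)"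
proof -
  define U where "U = \<Theta> \<inter> g -` ball (g s) d"
  have "open U"
    unfolding U_def using assms by (intro continuous_open_preimage) auto
  moreover have "s \<in> U" using assms by (simp add: U_def)
  ultimately obtain p W where pW: "p \<in> rational_points" "p \<in> U" "finite W" "W \<subseteq> rational_points"
    "convex hull W \<subseteq> U" "s \<in> interior (convex hull W)"
    "\<And>x. x \<in> convex hull W \<Longrightarrow> 2 *\<^sub>R p - x \<in> convex hull W"
    by (metis rational_cube_in_open)
  have gU: "\<bar>g x - g s\<bar> < d" if "x \<in> U" for x
    using that by (simp add: U_def dist_real_def abs_minus_commute)
  have WU: "W \<subseteq> U" using pW(5) hull_subset[of W convex] by blast
  have "h x \<le> g s + 6 * d"
    if h: "concave_on \<Theta> h" and K: "\<forall>q\<in>insert p W. \<bar>h q - g q\<bar> < d"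
      and x: "x \<in> interior (convex hull W)" for h x
  proof -
    have hull\<Theta>: "convex hull W \<subseteq> \<Theta>" using pW(5) by (auto simp: U_def)
    have "convex_on (convex hull W) (\<lambda>x. - h x)"
      using h hull\<Theta> convex_on_subset convex_convex_hull unfolding concave_on_def by blast
    moreover have "- h q \<le> - (g s - 2 * d)" if "q \<in> W" for q
    proof -
      have "\<bar>h q - g q\<bar> < d" "\<bar>g q - g s\<bar> < d" using that K gU WU by auto
      then show ?thesis by linarith
    qed
    \<comment> \<open>A concave function on a polytope is bounded below by its smallest value at the
      vertices.\<close>
    ultimately have lower: "h y \<ge> g s - 2 * d" if "y \<in> convex hull W" for y
      using convex_on_convex_hull_bound[of W "\<lambda>x. - h x" "- (g s - 2 * d)"] that by force
    have xW: "x \<in> convex hull W" using x interior_subset by blast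
    have mid: "(1 - 1/2) *\<^sub>R x + (1/2) *\<^sub>R (2 *\<^sub>R p - x) = p"
      by (simp add: algebra_simps)
    have "(1 - 1/2) * h x + (1/2) * h (2 *\<^sub>R p - x) \<le> h ((1 - 1/2) *\<^sub>R x + (1/2) *\<^sub>R (2 *\<^sub>R p - x))"
      using xW pW(7)[OF xW] hull\<Theta> by (intro concave_onD[OF h]) auto
    then have "h x + h (2 *\<^sub>R p - x) \<le> 2 * h p" unfolding mid by simp
    \<comment> \<open>Here \<open>h p < g s + 2 * d\<close> and the reflected point has value at
      least \<open>g s - 2 * d\<close>, so \<open>2 * h p - h (2 *\<^sub>R p - x)\<close> is below
      \<open>g s + 6 * d\<close>.\<close>
    then show "h x \<le> g s + 6 * d"
      using lower[OF pW(7)[OF xW]] K gU[OF pW(2)] by (auto simp: abs_less_iff)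
  qed
  moreover have "insert p W \<subseteq> \<Theta> \<inter> rational_points"
    using pW WU by (auto simp: U_def)
  ultimately show ?thesis
    using pW(3,6) by (intro exI[of _ "interior (convex hull W)"] exI[of _ "insert p W"]) simp
qed

text \<open>The strict maximum of \<open>g\<close> leaves a gap between \<open>g t\<close> and the
  values on a small sphere about \<open>t\<close>. A concave \<open>h\<close> close to
  \<open>g\<close> on \<open>K\<close> inherits the gap, and it cannot have a maximum point beyond a
  sphere on which it is smaller than at some point inside.\<close>

lemma concave_on_argmax_stable:
  fixes g :: "real ^ 'n \<Rightarrow> real"
  assumes "open \<Theta>" "concave_on \<Theta> g" "t \<in> \<Theta>" "e > 0"
    and max: "\<And>x. x \<in> \<Theta> \<Longrightarrow> x \<noteq> t \<Longrightarrow> g x < g t"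
  obtains K d where "finite K" "K \<subseteq> \<Theta> \<inter> rational_points" "d > 0"
    "\<And>h s. concave_on \<Theta> h \<Longrightarrow> s \<in> \<Theta> \<Longrightarrow> (\<And>y. y \<in> \<Theta> \<Longrightarrow> h y \<le> h s) \<Longrightarrow>
      (\<And>q. q \<in> K \<Longrightarrow> \<bar>h q - g q\<bar> < d) \<Longrightarrow> dist s t < e"
proof -
  have cont: "continuous_on \<Theta> g"
    using convex_on_continuous[OF assms(1), of "\<lambda>x. - g x"] assms(2) continuous_on_minus[of \<Theta> "\<lambda>x. - g x"]
    by (simp add: concave_on_def)
  obtain r0 where r0: "r0 > 0" "cball t r0 \<subseteq> \<Theta>"
    using assms open_contains_cball by blast
  define r where "r = min r0 (e / 2)"
  have r: "r > 0" "r < e" "cball t r \<subseteq> \<Theta>" using r0 assms(4) by (auto simp: r_def)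
  then have sphere: "sphere t r \<subseteq> \<Theta>" using sphere_cball by blast
  \<comment> \<open>On a nonempty sphere, \<open>m\<close> is the maximum of \<open>g\<close>,
    attained by compactness at a point other than \<open>t\<close>. On an empty one, any number
    below \<open>g t\<close> serves.\<close>
  obtain m where m: "m < g t" "\<And>x. x \<in> sphere t r \<Longrightarrow> g x \<le> m"
  proof (cases "sphere t r = {}")
    case True
    then show ?thesis using that[of "g t - 1"] by auto
  next
    case False
    then obtain x where x: "x \<in> sphere t r" "\<And>y. y \<in> sphere t r \<Longrightarrow> g y \<le> g x"
      using continuous_attains_sup[OF compact_sphere _ continuous_on_subset[OF cont sphere]] by blast
    moreover have "x \<noteq> t" using x(1) r by auto
    ultimately show ?thesis using that max sphere by blast
  qed
  \<comment> \<open>The gap is split into eight parts: six for the upper bound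
    \<open>m + 6 * d\<close> of \<open>h\<close> on the sphere, one for
    \<open>g q0 > g t - d\<close> and one for passing from \<open>g q0\<close> to
    \<open>h q0\<close>.\<close>
  define d where "d = (g t - m) / 8"
  have d: "d > 0" "g t = m + 8 * d" using m(1) by (simp_all add: d_def field_simps)
  have "\<forall>s\<in>sphere t r. \<exists>V K. open V \<and> s \<in> V \<and> finite K \<and> K \<subseteq> \<Theta> \<inter> rational_points \<and>
     (\<forall>h x. concave_on \<Theta> h \<longrightarrow> (\<forall>q\<in>K. \<bar>h q - g q\<bar> < d) \<longrightarrow> x \<in> V \<longrightarrow> h x \<le> g s + 6 * d)"
    using concave_on_local_upper_bound[OF assms(1) cont _ d(1)] sphere by auto
  then obtain V K where VK: "\<And>s. s \<in> sphere t r \<Longrightarrow> open (V s) \<and> s \<in> V s \<and> finite (K s) \<and>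
      K s \<subseteq> \<Theta> \<inter> rational_points \<and>
      (\<forall>h x. concave_on \<Theta> h \<longrightarrow> (\<forall>q\<in>K s. \<bar>h q - g q\<bar> < d) \<longrightarrow> x \<in> V s \<longrightarrow> h x \<le> g s + 6 * d)"
    by metis
  obtain C where C: "C \<subseteq> sphere t r" "finite C" "sphere t r \<subseteq> (\<Union>s\<in>C. V s)"
    using compactE_image[OF compact_sphere, of "sphere t r" V t r] VK by blast
  \<comment> \<open>The maximum point \<open>t\<close> may be irrational, so closeness of
    \<open>h\<close> to \<open>g\<close> cannot be demanded there. By continuity a rational
    \<open>q0\<close> inside the ball with almost the same value replaces it.\<close>
  define U where "U = (\<Theta> \<inter> g -` {g t - d <..}) \<inter> ball t r"
  have "open U" unfolding U_def
    using assms(1) cont by (intro open_Int open_ball continuous_open_preimage) auto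
  moreover have "t \<in> U" using assms d r by (simp add: U_def)
  ultimately obtain q0 where q0: "q0 \<in> rational_points" "q0 \<in> U"
    by (metis rational_cube_in_open)
  show ?thesis
  proof (rule that[of "insert q0 (\<Union>s\<in>C. K s)" d])
    show "finite (insert q0 (\<Union>s\<in>C. K s))" using C VK by auto
    show "insert q0 (\<Union>s\<in>C. K s) \<subseteq> \<Theta> \<inter> rational_points"
      using q0 C VK unfolding U_def by blast
    show "d > 0" by (fact d)
    fix h s
    assume h: "concave_on \<Theta> h" and s: "s \<in> \<Theta>" and hs: "\<And>y. y \<in> \<Theta> \<Longrightarrow> h y \<le> h s"
      and near: "\<And>q. q \<in> insert q0 (\<Union>s\<in>C. K s) \<Longrightarrow> \<bar>h q - g q\<bar> < d"
    have hq0: "h q0 > m + 6 * d"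
      using near[of q0] q0(2) d by (simp add: U_def abs_less_iff)
    have on_sphere: "h x \<le> m + 6 * d" if x: "x \<in> sphere t r" for x
    proof -
      obtain c where c: "c \<in> C" "x \<in> V c" using C x by blast
      then have "h x \<le> g c + 6 * d" using VK[of c] C(1) h near by blast
      also have "\<dots> \<le> m + 6 * d" using m c C by auto
      finally show ?thesis .
    qed
    have "s \<in> ball t r"
    proof (rule ccontr)
      \<comment> \<open>The segment from \<open>q0\<close> to \<open>s\<close> would cross the
        sphere at some \<open>x\<close>. By concavity \<open>h x\<close> is at least the smaller of
        the two end values, which is \<open>h q0\<close>, against the bound on the sphere.\<close>
      assume "s \<notin> ball t r"
      then have "closed_segment q0 s \<inter> frontier (ball t r) \<noteq> {}"
        using q0 by (intro connected_Int_frontier) (auto simp: U_def)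
      then obtain x where x: "x \<in> closed_segment q0 s" "x \<in> sphere t r"
        unfolding frontier_ball[OF r(1)] by blast
      then obtain u where u: "0 \<le> u" "u \<le> 1" "x = (1 - u) *\<^sub>R q0 + u *\<^sub>R s"
        by (auto simp: in_segment)
      have q0\<Theta>: "q0 \<in> \<Theta>" using q0 by (simp add: U_def)
      have "(1 - u) * h q0 + u * h q0 \<le> (1 - u) * h q0 + u * h s"
        using hs[OF q0\<Theta>] u by (intro add_left_mono mult_left_mono)
      also have "\<dots> \<le> h x"
        unfolding u(3) using u q0\<Theta> s by (intro concave_onD[OF h])
      finally have "h q0 \<le> h x" by (simp add: algebra_simps)
      with on_sphere[OF x(2)] hq0 show False by linarith
    qed
    then show "dist s t < e" using r by (simp add: dist_commute)
  qed
qed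

section \<open>Log-likelihoods and the gauge weak topology\<close>

lemma integral_concave_on:
  fixes F :: "'p::real_vector \<Rightarrow> 'a \<Rightarrow> real"
  assumes "convex S" "\<And>x. concave_on S (\<lambda>\<theta>. F \<theta> x)" "\<And>\<theta>. \<theta> \<in> S \<Longrightarrow> integrable M (F \<theta>)"
  shows "concave_on S (\<lambda>\<theta>. \<integral>x. F \<theta> x \<partial>M)"
  unfolding concave_on_iff
proof (intro conjI ballI allI impI)
  fix a b and u v :: real
  assume ab: "a \<in> S" "b \<in> S" and uv: "0 \<le> u" "0 \<le> v" "u + v = 1"
  then have "u *\<^sub>R a + v *\<^sub>R b \<in> S" using assms(1) by (simp add: convex_def)
  moreover have "u * F a x + v * F b x \<le> F (u *\<^sub>R a + v *\<^sub>R b) x" for x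
    using assms(2)[of x] ab uv unfolding concave_on_iff by blast
  ultimately have "(\<integral>x. u * F a x + v * F b x \<partial>M) \<le> (\<integral>x. F (u *\<^sub>R a + v *\<^sub>R b) x \<partial>M)"
    using ab by (intro integral_mono) (auto intro!: assms)
  then show "u * (\<integral>x. F a x \<partial>M) + v * (\<integral>x. F b x \<partial>M) \<le> (\<integral>x. F (u *\<^sub>R a + v *\<^sub>R b) x \<partial>M)"
    using ab by (simp add: assms)
qed (fact assms)

lemma openin_gauge_weak_topology_integral:
  assumes "g \<in> gauge_test_functions \<psi>" "open U"
  shows "openin (gauge_weak_topology \<psi>) {\<mu> \<in> gauge_measures \<psi>. (\<integral>x. g x \<partial>\<mu>) \<in> U}"
  unfolding gauge_weak_topology_def
  by (rule topology_generated_by_Basis) (use assms in blast)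

theorem theorem4p3:
  fixes \<Theta> :: "(real ^ 'n) set"
    and lam :: "'a::polish_space measure"
    and P :: "real ^ 'n \<Rightarrow> 'a measure"
    and f :: "real ^ 'n \<Rightarrow> 'a \<Rightarrow> real"
    and \<theta>\<^sub>s :: "nat \<Rightarrow> real ^ 'n"
    and \<psi> :: "nat \<Rightarrow> 'a \<Rightarrow> real"
    and \<M> :: "'a measure set"
    and T :: "'a measure \<Rightarrow> real ^ 'n"
    and \<mu> :: "'a measure"
  assumes "open \<Theta>" and "convex \<Theta>"
    and "sets lam = sets borel" and "sigma_finite_measure lam"
    and "\<And>\<theta>. \<theta> \<in> \<Theta> \<Longrightarrow> P \<theta> \<in> \<M>\<^sub>1"
    and "\<And>\<theta>. \<theta> \<in> \<Theta> \<Longrightarrow> absolutely_continuous lam (P \<theta>)"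
    and "\<And>\<theta>. \<theta> \<in> \<Theta> \<Longrightarrow> f \<theta> \<in> borel_measurable lam"
    and "\<And>\<theta>. \<theta> \<in> \<Theta> \<Longrightarrow> P \<theta> = density lam (\<lambda>x. ennreal (f \<theta> x))"
    and "\<And>\<theta> x. \<theta> \<in> \<Theta> \<Longrightarrow> f \<theta> x > 0"
    and "\<And>\<theta>. \<theta> \<in> \<Theta> \<Longrightarrow> continuous_on UNIV (\<lambda>x. ln (f \<theta> x))"
    and "\<And>x. concave_on \<Theta> (\<lambda>\<theta>. ln (f \<theta> x))"
    and "range \<theta>\<^sub>s = \<Theta> \<inter> rational_points"
    and "\<And>k x. \<psi> k x = \<bar>ln (f (\<theta>\<^sub>s k) x)\<bar>"
    and "\<M> \<subseteq> \<M>\<^sub>1"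
    and "ml_functional \<Theta> f \<M> T"
    and "\<mu> \<in> \<M>"
    and "\<exists>!\<theta>. is_arg_max (\<L> f \<mu>) (\<lambda>\<theta>. \<theta> \<in> \<Theta>) \<theta>"
  shows "(\<forall>\<nu> :: nat \<Rightarrow> 'a measure.
            (\<forall>n. \<nu> n \<in> \<M>) \<longrightarrow>
            (\<forall>k. (\<lambda>n. \<L> f (\<nu> n) (\<theta>\<^sub>s k)) \<longlonglongrightarrow> \<L> f \<mu> (\<theta>\<^sub>s k)) \<longrightarrow>
            (\<lambda>n. T (\<nu> n)) \<longlonglongrightarrow> T \<mu>)
       \<and> topcontinuous_at (subtopology (gauge_weak_topology \<psi>) \<M>) (top_of_set \<Theta>) T \<mu>"
proof -
  note \<Theta> = assms(1,2) and conc = assms(11) and cont = assms(10)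
    and \<theta>s = assms(12) and \<psi> = assms(13) and \<M> = assms(14) and ml = assms(15)
  have int: "integrable \<nu> (\<lambda>x. ln (f \<theta> x))" if "\<nu> \<in> \<M>" "\<theta> \<in> \<Theta>" for \<nu> \<theta>
  proof -
    have "sets \<nu> = sets borel" using that \<M> by (auto simp: borel_prob_measures_def)
    then have "(\<lambda>x. ln (f \<theta> x)) \<in> borel_measurable \<nu>"
      using borel_measurable_continuous_onI[OF cont[OF that(2)]]
      by (simp cong: measurable_cong_sets)
    moreover have "integrable \<nu> (\<lambda>x. \<bar>ln (f \<theta> x)\<bar>)"
      using ml that by (simp add: ml_functional_def)
    ultimately show ?thesis by (rule integrable_abs_cancel[rotated])
  qed
  have conc_\<L>: "concave_on \<Theta> (\<L> f \<nu>)" if "\<nu> \<in> \<M>" for \<nu>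
    using integral_concave_on[OF \<Theta>(2) conc int[OF that]]
    by (simp add: log_likelihood_def[abs_def])
  have T\<Theta>: "T \<nu> \<in> \<Theta>" and T_max: "\<And>y. y \<in> \<Theta> \<Longrightarrow> \<L> f \<nu> y \<le> \<L> f \<nu> (T \<nu>)" if "\<nu> \<in> \<M>" for \<nu>
    using ml that by (auto simp: ml_functional_def is_arg_max_linorder)
  \<comment> \<open>Uniqueness of the maximum point is recast as the strict inequality required by
    \<open>concave_on_argmax_stable\<close>.\<close>
  have uniq: "\<L> f \<mu> x < \<L> f \<mu> (T \<mu>)" if "x \<in> \<Theta>" "x \<noteq> T \<mu>" for x
  proof (rule ccontr)
    assume "\<not> \<L> f \<mu> x < \<L> f \<mu> (T \<mu>)"
    then have "is_arg_max (\<L> f \<mu>) (\<lambda>\<theta>. \<theta> \<in> \<Theta>) x"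
      using T_max[OF assms(16)] that by (force simp: is_arg_max_linorder)
    moreover have "is_arg_max (\<L> f \<mu>) (\<lambda>\<theta>. \<theta> \<in> \<Theta>) (T \<mu>)"
      using ml assms(16) by (simp add: ml_functional_def)
    ultimately show False using assms(17) that by blast
  qed
  \<comment> \<open>Common core of both claims: finitely many indices and one tolerance control
    \<open>T\<close>. The enumeration \<open>\<theta>\<^sub>s\<close> reaches every rational point
    of \<Theta>, so the finite set \<open>K\<close> of points becomes a finite set \<open>I\<close>
    of indices.\<close>
  have stable: "\<exists>I d. finite I \<and> d > 0 \<and>
      (\<forall>\<nu>\<in>\<M>. (\<forall>k\<in>I. \<bar>\<L> f \<nu> (\<theta>\<^sub>s k) - \<L> f \<mu> (\<theta>\<^sub>s k)\<bar> < d) \<longrightarrow> dist (T \<nu>) (T \<mu>) < e)"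
    if "e > 0" for e
  proof -
    from concave_on_argmax_stable[OF \<Theta>(1) conc_\<L>[OF assms(16)] T\<Theta>[OF assms(16)] that uniq]
    obtain K d where K: "finite K" "K \<subseteq> \<Theta> \<inter> rational_points" and d: "d > 0"
      and close: "\<And>h s. concave_on \<Theta> h \<Longrightarrow> s \<in> \<Theta> \<Longrightarrow> (\<And>y. y \<in> \<Theta> \<Longrightarrow> h y \<le> h s) \<Longrightarrow>
        (\<And>q. q \<in> K \<Longrightarrow> \<bar>h q - \<L> f \<mu> q\<bar> < d) \<Longrightarrow> dist s (T \<mu>) < e"
      by metis
    obtain I where I: "finite I" "K = \<theta>\<^sub>s ` I"
      using K \<theta>s finite_subset_image[of K \<theta>\<^sub>s UNIV] by auto
    have "dist (T \<nu>) (T \<mu>) < e"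
      if "\<nu> \<in> \<M>" "\<forall>k\<in>I. \<bar>\<L> f \<nu> (\<theta>\<^sub>s k) - \<L> f \<mu> (\<theta>\<^sub>s k)\<bar> < d" for \<nu>
      by (rule close[OF conc_\<L> T\<Theta> T_max]) (use that I in auto)
    with I(1) d show ?thesis by blast
  qed
  show ?thesis
  proof (intro conjI allI impI)
    fix \<nu> :: "nat \<Rightarrow> 'a measure"
    assume \<nu>: "\<forall>n. \<nu> n \<in> \<M>"
      and lim: "\<forall>k. (\<lambda>n. \<L> f (\<nu> n) (\<theta>\<^sub>s k)) \<longlonglongrightarrow> \<L> f \<mu> (\<theta>\<^sub>s k)"
    show "(\<lambda>n. T (\<nu> n)) \<longlonglongrightarrow> T \<mu>"
    proof (rule tendstoI)
      fix e :: real assume "e > 0"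
      from stable[OF this] obtain I d where I: "finite I" "d > 0" and
        close: "\<forall>\<nu>\<in>\<M>. (\<forall>k\<in>I. \<bar>\<L> f \<nu> (\<theta>\<^sub>s k) - \<L> f \<mu> (\<theta>\<^sub>s k)\<bar> < d) \<longrightarrow> dist (T \<nu>) (T \<mu>) < e"
        by blast
      \<comment> \<open>Finiteness of \<open>I\<close> turns convergence at each single index into
        simultaneous closeness.\<close>
      have "\<forall>\<^sub>F n in sequentially. \<forall>k\<in>I. \<bar>\<L> f (\<nu> n) (\<theta>\<^sub>s k) - \<L> f \<mu> (\<theta>\<^sub>s k)\<bar> < d"
        using I lim by (intro eventually_ball_finite) (auto simp: tendsto_iff dist_real_def)
      then show "\<forall>\<^sub>F n in sequentially. dist (T (\<nu> n)) (T \<mu>) < e"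
        by eventually_elim (use close \<nu> in blast)
    qed
  next
    let ?X = "subtopology (gauge_weak_topology \<psi>) \<M>"
    have \<theta>s_in: "\<theta>\<^sub>s k \<in> \<Theta>" for k using \<theta>s by blast
    have gauge: "\<M> \<subseteq> gauge_measures \<psi>"
      using \<M> int \<theta>s_in by (auto simp: gauge_measures_def \<psi>[abs_def])
    \<comment> \<open>The log-density at \<open>\<theta>\<^sub>s k\<close> is dominated by
      \<open>1 + \<psi> k\<close>, with constant 1, so evaluating the log-likelihood at
      \<open>\<theta>\<^sub>s k\<close> is one of the maps that generate the topology.\<close>
    have test: "(\<lambda>x. ln (f (\<theta>\<^sub>s k) x)) \<in> gauge_test_functions \<psi>" for k
    proof -
      have "\<bar>ln (f (\<theta>\<^sub>s k) x) / (1 + \<psi> k x)\<bar> \<le> 1" for x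
        by (simp add: \<psi> abs_div field_simps)
      then have "bdd_above (range (\<lambda>x. \<bar>ln (f (\<theta>\<^sub>s k) x) / (1 + \<psi> k x)\<bar>))"
        by (auto intro!: bdd_aboveI[of _ 1])
      then show ?thesis
        using cont[OF \<theta>s_in] unfolding gauge_test_functions_def by blast
    qed
    show "topcontinuous_at ?X (top_of_set \<Theta>) T \<mu>"
      unfolding topcontinuous_at_def
    proof (intro conjI allI impI)
      show "\<mu> \<in> topspace ?X"
        using gauge assms(16) by (auto simp: topspace_gauge_weak_topology)
      show "T \<in> topspace ?X \<rightarrow> topspace (top_of_set \<Theta>)"
        using T\<Theta> by auto
      fix V assume V: "openin (top_of_set \<Theta>) V \<and> T \<mu> \<in> V"
      then obtain e where e: "e > 0" "ball (T \<mu>) e \<inter> \<Theta> \<subseteq> V"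
        unfolding openin_contains_ball by blast
      from stable[OF e(1)] obtain I d where I: "finite I" "d > 0" and
        close: "\<forall>\<nu>\<in>\<M>. (\<forall>k\<in>I. \<bar>\<L> f \<nu> (\<theta>\<^sub>s k) - \<L> f \<mu> (\<theta>\<^sub>s k)\<bar> < d) \<longrightarrow> dist (T \<nu>) (T \<mu>) < e"
        by blast
      define N where "N k = {\<nu> \<in> gauge_measures \<psi>. \<L> f \<nu> (\<theta>\<^sub>s k) \<in> ball (\<L> f \<mu> (\<theta>\<^sub>s k)) d}" for k
      \<comment> \<open>Intersecting with the whole space keeps \<open>U\<close> open even for empty
        \<open>I\<close>, which \<open>stable\<close> does not exclude.\<close>
      define U where "U = (\<Inter>k\<in>I. N k) \<inter> topspace (gauge_weak_topology \<psi>)"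
      have "openin (gauge_weak_topology \<psi>) (N k)" for k
        unfolding N_def log_likelihood_def
        by (rule openin_gauge_weak_topology_integral[OF test open_ball])
      then have "openin (gauge_weak_topology \<psi>) U"
        unfolding U_def using I(1) by (intro openin_INT)
      then have "openin ?X (U \<inter> \<M>)" by (rule openin_subtopology_Int)
      moreover have "\<mu> \<in> U \<inter> \<M>"
        using assms(16) gauge I by (auto simp: U_def N_def topspace_gauge_weak_topology)
      moreover have "T \<nu> \<in> V" if "\<nu> \<in> U \<inter> \<M>" for \<nu>
      proof -
        have "dist (T \<nu>) (T \<mu>) < e"
          using that by (intro close[rule_format]) (auto simp: U_def N_def dist_real_def abs_minus_commute)
        then show ?thesis using e(2) T\<Theta> that by (auto simp: dist_commute)
      qed
      ultimately show "\<exists>U. openin ?X U \<and> \<mu> \<in> U \<and> (\<forall>y\<in>U. T y \<in> V)" by blast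
    qed
  qed
qed

end
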